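(* Let $N\ge 3$ and let $\ell$ be an arbitrary integer with $1\le\ell\le N-2$. Then almost every complex-valued signal $x$ with support $\{0,\dots,N-1\}$ can be uniquely recovered from $|\widehat x|$, $\arg x[N-1]$, and $\arg x[N-1-\ell]$.
   Context: A (discrete-time) signal is a sequence $x=(x[n])_{n\in\mathbb Z}$ of complex numbers. It has support $\{0,\dots,N-1\}$ if $x[n]=0$ for $n\notin\{0,\dots,N-1\}$ and $x[0]\neq0$, $x[N-1]\ne 0$ (interior values may vanish). Its Fourier transform is $\widehat x(\omega)=\sum_{n\in\mathbb Z}x[n]e^{-i\omega n}$, $\omega\in\mathbb R$, and $|\widehat x|$ is the function $\omega\mapsto|\widehat x(\omega)|$ (the Fourier intensity). Signals with support $\{0,\dots,N-1\}$ are identified with vectors $(\operatorname{Re}x[0],\operatorname{Im}x[0],\dots,\operatorname{Re}x[N-1],\operatorname{Im}x[N-1])\in\mathbb R^{2N}$; "almost every" means for all outside a set of $2N$-dimensional Lebesgue measure zero. Phases are understood modulo $2\pi$. The phase of $0$ is not uniquely defined, and the convention is that the condition $\arg z=\arg w$ counts as satisfied whenever $z=0$ or $w=0$. "$x$ can be uniquely recovered from $|\widehat x|$, $\arg x[N-1]$, and $\arg x[N-1-\ell]$" means that the only signal $y$ with support $\{0,\dots,N-1\}$ satisfying $|\widehat y|=|\widehat x|$, $\arg y[N-1]=\arg x[N-1]$ and $\arg y[N-1-\ell]=\arg x[N-1-\ell]$ is $y=x$. *)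

theory Defs
  imports "HOL-Analysis.Analysis"
begin

type_synonym signal = "int \<Rightarrow> complex"

definition has_support :: "nat \<Rightarrow> signal \<Rightarrow> bool" where
  "has_support N x \<longleftrightarrow>
     (\<forall>n. n \<notin> {0..int N - 1} \<longrightarrow> x n = 0) \<and> x 0 \<noteq> 0 \<and> x (int N - 1) \<noteq> 0"

definition fourier :: "signal \<Rightarrow> real \<Rightarrow> complex" where
  "fourier x \<omega> = (\<Sum>\<^sub>\<infinity>n. x n * exp (- \<i> * of_real \<omega> * of_int n))"

definition fourier_intensity :: "signal \<Rightarrow> real \<Rightarrow> real" where
  "fourier_intensity x = (\<lambda>\<omega>. norm (fourier x \<omega>))"

text \<open>
  Phases are compared modulo \<open>2 * pi\<close>, which for nonzero numbers is equality of the principal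
  values \<^const>\<open>Arg\<close>.  Since \<open>0\<close> has no well-defined phase, it agrees in phase with every number;
  the relation is therefore not transitive.
\<close>

definition same_phase :: "complex \<Rightarrow> complex \<Rightarrow> bool" where
  "same_phase z w \<longleftrightarrow> z = 0 \<or> w = 0 \<or> Arg z = Arg w"

definition uniquely_recoverable :: "nat \<Rightarrow> int \<Rightarrow> signal \<Rightarrow> bool" where
  "uniquely_recoverable N l x \<longleftrightarrow>
     (\<forall>y. has_support N y \<and> fourier_intensity y = fourier_intensity x \<and>
          same_phase (y (int N - 1)) (x (int N - 1)) \<and>
          same_phase (y (int N - 1 - l)) (x (int N - 1 - l)) \<longrightarrow> y = x)"

text \<open>
  The vector \<open>(Re x[0], Im x[0], \<dots>, Re x[N-1], Im x[N-1])\<close>, as an extensional function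
  on \<open>{..<2 * N}\<close>, i.e. a point of the space of \<open>lebesgue_coords N\<close>.
\<close>

definition signal_coords :: "nat \<Rightarrow> signal \<Rightarrow> nat \<Rightarrow> real" where
  "signal_coords N x =
     (\<lambda>k\<in>{..<2 * N}. if even k then Re (x (int (k div 2))) else Im (x (int (k div 2))))"

text \<open>\<open>2 * N\<close>-dimensional Lebesgue measure: the completion of the product Borel measure.\<close>

definition lebesgue_coords :: "nat \<Rightarrow> (nat \<Rightarrow> real) measure" where
  "lebesgue_coords N = completion (\<Pi>\<^sub>M k\<in>{..<2 * N}. lborel)"

definition almost_every_signal :: "nat \<Rightarrow> (signal \<Rightarrow> bool) \<Rightarrow> bool" where
  "almost_every_signal N P \<longleftrightarrow>
     (\<exists>Z \<in> null_sets (lebesgue_coords N).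
        \<forall>x. has_support N x \<and> signal_coords N x \<notin> Z \<longrightarrow> P x)"

end

theory Submission
  imports Defs "HOL-Computational_Algebra.Fundamental_Theorem_Algebra"
begin

text \<open>
  Put \<open>n = N - 1\<close> and identify a signal with the polynomial \<open>x[0] + x[1] z + \<dots> + x[n] z^n\<close>,
  which factors as \<open>c (1 - b\<^sub>1 z) \<cdots> (1 - b\<^sub>n z)\<close>.  On the unit circle \<open>\<bar>1 - b z\<bar> = \<bar>z - cnj b\<bar>\<close>, and
  unique factorization shows that every signal with the same intensity arises, up to a
  unimodular constant, by replacing the factors with index in some set \<open>J\<close> in this way
  (\<open>reflected_prod_of_circle_norm\<close>).  If \<open>J\<close> is empty, the phase of the last coefficient fixes the
  constant.  If \<open>J\<close> is nonempty, the phases of the coefficients \<open>n\<close> and \<open>k = n - l\<close> agree with those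
  of \<open>x\<close> only if a certain polynomial expression \<open>phase_product J k\<close> in the \<open>b\<^sub>i\<close> and their
  conjugates is real.

  Its imaginary part is not identically zero: put \<open>b\<^sub>i = -1\<close> for all \<open>i\<close> except one \<open>j \<in> J\<close>, where
  \<open>b\<^sub>j = -2 \<i>\<close>.  Reflection leaves the factor \<open>1 + z\<close> alone, so the expression can be evaluated by
  binomial coefficients; it is here that \<open>0 < k < n\<close> is used.  (For \<open>k = 0\<close> it would vanish
  identically for \<open>J = {..<n}\<close>, as reflecting all factors does not change the phase of \<open>x[0]\<close>
  relative to \<open>x[n]\<close>.)  A polynomial in real variables that is not identically zero vanishes only
  on a null set, so almost every choice of \<open>b\<^sub>1, \<dots>, b\<^sub>n, c\<close> gives a recoverable signal.

  It remains to pass from the parameters \<open>b\<^sub>i, c\<close> to coefficients (\<open>AE_coeffs_from_roots\<close>), one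
  factor at a time.  Multiplication of a polynomial \<open>q\<close> of degree \<open>n\<close> by \<open>1 - b z\<close> changes the
  coefficients \<open>0, \<dots>, n\<close> of \<open>q\<close> by a unipotent triangular map, which respects null sets, and the
  new last coefficient is a nonconstant polynomial in \<open>b\<close> once the others are held fixed.  Such a
  polynomial maps \<open>\<complex>\<close> onto \<open>\<complex>\<close> and null sets to null sets, so a property that holds for almost all
  \<open>b\<close> holds for almost all values of the last coefficient.  The interchange of \<open>b\<close> with the other
  coefficients needs Fubini's theorem, hence the measurability of the set of ambiguous signals.
  The possibly larger set described by \<open>ambiguous\<close> is Borel because it is a countable union of
  projections of compact sets.
\<close>

section \<open>Null sets of Lebesgue measure\<close>

lemma AE_lborel_iff_negligible:
  fixes P :: "'a::euclidean_space \<Rightarrow> bool"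
  shows "(AE x in lborel. P x) \<longleftrightarrow> negligible {x. \<not> P x}"
  using AE_completion_iff[of P lborel] by (simp add: completion.AE_iff_null_sets negligible_iff_null_sets)

text \<open>
  A differentiable map that does not lower the dimension sends null sets to null sets, and by
  surjectivity the exceptional set of \<open>P\<close> is the image of that of \<open>P \<circ> f\<close>.
\<close>
lemma AE_lborel_surj_image:
  fixes f :: "'a::euclidean_space \<Rightarrow> 'b::euclidean_space"
  assumes "DIM('a) \<le> DIM('b)" and "f differentiable_on UNIV" and "surj f"
    and "AE x in lborel. P (f x)"
  shows "AE y in lborel. P y"
proof -
  have "negligible (f ` {x. \<not> P (f x)})"
    using assms by (intro negligible_differentiable_image_negligible)
      (auto simp: AE_lborel_iff_negligible intro: differentiable_on_subset)
  moreover have "f ` {x. \<not> P (f x)} = {y. \<not> P y}"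
    using \<open>surj f\<close> by auto
  ultimately show ?thesis
    by (simp add: AE_lborel_iff_negligible)
qed

lemma AE_lborel_translation:
  fixes c :: "'a::euclidean_space"
  assumes "AE x in lborel. P (c + x)"
  shows "AE x in lborel. P x"
proof (rule AE_lborel_surj_image[where f = "(+) c"])
  show "surj ((+) c)" by (rule surj_plus)
qed (use assms in \<open>auto intro!: derivative_intros\<close>)

lemma AE_polynomial_image:
  fixes p :: "complex poly"
  assumes "degree p > 0" and "AE b in lborel. S (poly p b)"
  shows "AE t in lborel. S t"
proof (rule AE_lborel_surj_image[where f = "poly p"])
  have "\<exists>b. poly p b = t" for t
  proof -
    have "degree (p + [:-t:]) > 0" using assms(1) by (subst degree_add_eq_left) auto
    from alg_closed_imp_poly_has_root[OF this] show ?thesis by auto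
  qed
  then show "surj (poly p)" by (metis surjI)
  show "poly p differentiable_on UNIV"
    by (auto simp: differentiable_on_def differentiable_def
        intro!: has_field_derivative_imp_has_derivative poly_DERIV)
qed (use assms in simp_all)

lemma AE_lborel_Complex:
  assumes "AE z in lborel. P z"
  shows "AE u in lborel. AE v in lborel. P (Complex u v)"
proof -
  have "AE w in lborel. P (Complex (fst w) (snd w))"
  proof (rule AE_lborel_surj_image[where f = "\<lambda>z. (Re z, Im z)"])
    show "(\<lambda>z. (Re z, Im z)) differentiable_on UNIV"
      by (intro linear_imp_differentiable_on) (auto intro!: linearI)
    show "surj (\<lambda>z. (Re z, Im z))"
      by (rule surjI[where f = "\<lambda>w. Complex (fst w) (snd w)"]) simp
  qed (use assms in simp_all)
  then have "AE w in lborel \<Otimes>\<^sub>M lborel. P (Complex (fst w) (snd w))"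
    unfolding lborel_prod .
  from lborel_pair.AE_pair[OF this] show ?thesis by simp
qed

text \<open>
  Fubini's theorem for null sets of a finite product.  The second part lets the first one be
  iterated.
\<close>
lemma (in product_sigma_finite) AE_PiM_insert:
  assumes I: "finite I" "i \<notin> I"
    and P: "Measurable.pred (PiM (insert i I) M) P"
  shows "(AE x in PiM (insert i I) M. P x) \<longleftrightarrow> (AE x in PiM I M. AE y in M i. P (x(i := y)))"
    and "Measurable.pred (PiM I M) (\<lambda>x. AE y in M i. P (x(i := y)))"
proof -
  let ?f = "\<lambda>x. indicator {x. \<not> P x} x :: ennreal"
  have f: "?f \<in> borel_measurable (PiM (insert i I) M)"
    using P by measurable
  have upd: "(\<lambda>(x, y). x(i := y)) \<in> measurable (PiM I M \<Otimes>\<^sub>M M i) (PiM (insert i I) M)"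
    by (rule measurable_add_dim)
  have f2: "(\<lambda>(x, y). ?f (x(i := y))) \<in> borel_measurable (PiM I M \<Otimes>\<^sub>M M i)"
    using measurable_compose[OF upd f] by (simp add: split_def)
  have f1: "(\<lambda>x. \<integral>\<^sup>+ y. ?f (x(i := y)) \<partial>M i) \<in> borel_measurable (PiM I M)"
    by (rule sigma_finite_measure.borel_measurable_nn_integral[OF sigma_finite_measures f2])
  have inner: "(AE y in M i. P (x(i := y))) \<longleftrightarrow> (\<integral>\<^sup>+ y. ?f (x(i := y)) \<partial>M i) = 0"
    if "x \<in> space (PiM I M)" for x
  proof -
    have "(\<lambda>y. ?f (x(i := y))) \<in> borel_measurable (M i)"
      using measurable_compose[OF measurable_Pair1'[OF that] f2] by simp
    then show ?thesis
      by (subst nn_integral_0_iff_AE) (auto simp: indicator_def)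
  qed
  have "(AE x in PiM (insert i I) M. P x) \<longleftrightarrow> integral\<^sup>N (PiM (insert i I) M) ?f = 0"
    by (subst nn_integral_0_iff_AE[OF f]) (auto simp: indicator_def)
  also have "\<dots> \<longleftrightarrow> (AE x in PiM I M. (\<integral>\<^sup>+ y. ?f (x(i := y)) \<partial>M i) = 0)"
    by (subst product_nn_integral_insert[OF I f]) (rule nn_integral_0_iff_AE[OF f1])
  also have "\<dots> \<longleftrightarrow> (AE x in PiM I M. AE y in M i. P (x(i := y)))"
    by (intro AE_cong) (simp add: inner)
  finally show "(AE x in PiM (insert i I) M. P x) \<longleftrightarrow> (AE x in PiM I M. AE y in M i. P (x(i := y)))" .
  have "Measurable.pred (PiM I M) (\<lambda>x. (\<integral>\<^sup>+ y. ?f (x(i := y)) \<partial>M i) = 0)"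
    using f1 by measurable
  then show "Measurable.pred (PiM I M) (\<lambda>x. AE y in M i. P (x(i := y)))"
    by (subst measurable_cong) (auto simp: inner)
qed

section \<open>Almost every list of complex numbers\<close>

text \<open>
  Iterated quantification over one entry at a time, the first entry being outermost, rather than
  almost everywhere in a product measure: it commutes with conjunctions for arbitrary predicates
  and is suited to induction on the number of entries.
\<close>
primrec ae_list :: "nat \<Rightarrow> (complex list \<Rightarrow> bool) \<Rightarrow> bool" where
  "ae_list 0 P \<longleftrightarrow> P []"
| "ae_list (Suc n) P \<longleftrightarrow> (AE z in lborel. ae_list n (\<lambda>zs. P (z # zs)))"

lemma ae_list_mono:
  assumes "ae_list n P" and "\<And>zs. length zs = n \<Longrightarrow> P zs \<Longrightarrow> Q zs"
  shows "ae_list n Q"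
  using assms
proof (induction n arbitrary: P Q)
  case (Suc n)
  have "AE z in lborel. ae_list n (\<lambda>zs. P (z # zs))" using Suc.prems(1) by simp
  then have "AE z in lborel. ae_list n (\<lambda>zs. Q (z # zs))"
    by (rule eventually_mono) (erule Suc.IH, use Suc.prems(2) in auto)
  then show ?case by simp
qed simp

lemma ae_list_conj:
  assumes "ae_list n P" and "ae_list n Q"
  shows "ae_list n (\<lambda>zs. P zs \<and> Q zs)"
  using assms
proof (induction n arbitrary: P Q)
  case (Suc n)
  have "AE z in lborel. ae_list n (\<lambda>zs. P (z # zs))" "AE z in lborel. ae_list n (\<lambda>zs. Q (z # zs))"
    using Suc.prems by simp_all
  then have "AE z in lborel. ae_list n (\<lambda>zs. P (z # zs) \<and> Q (z # zs))"
    by eventually_elim (rule Suc.IH)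
  then show ?case by simp
qed simp

lemma ae_list_True: "ae_list n (\<lambda>_. True)"
  by (induction n) auto

lemma ae_list_ball:
  assumes "finite S" and "\<And>s. s \<in> S \<Longrightarrow> ae_list n (P s)"
  shows "ae_list n (\<lambda>zs. \<forall>s\<in>S. P s zs)"
  using assms by (induction S) (auto simp: ae_list_True intro: ae_list_conj)

lemma ae_list_all:
  assumes "AE z in lborel. P z"
  shows "ae_list n (\<lambda>zs. \<forall>z\<in>set zs. P z)"
proof (induction n)
  case (Suc n)
  have "AE z in lborel. ae_list n (\<lambda>zs. \<forall>w\<in>set (z # zs). P w)"
    using assms by (rule eventually_mono) (rule ae_list_mono[OF Suc.IH], simp)
  then show ?case by simp
qed simp

section \<open>Polynomials in complex variables and their conjugates\<close>

text \<open>
  These are exactly the complex polynomials in the real and imaginary parts of the entries.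
\<close>
inductive conj_poly :: "(complex list \<Rightarrow> complex) \<Rightarrow> bool" where
  const: "conj_poly (\<lambda>_. c)"
| var: "conj_poly (\<lambda>zs. zs ! i)"
| cnj: "conj_poly f \<Longrightarrow> conj_poly (\<lambda>zs. cnj (f zs))"
| add: "conj_poly f \<Longrightarrow> conj_poly g \<Longrightarrow> conj_poly (\<lambda>zs. f zs + g zs)"
| mult: "conj_poly f \<Longrightarrow> conj_poly g \<Longrightarrow> conj_poly (\<lambda>zs. f zs * g zs)"

lemma conj_poly_diff:
  assumes "conj_poly f" and "conj_poly g"
  shows "conj_poly (\<lambda>zs. f zs - g zs)"
  using conj_poly.add[OF assms(1) conj_poly.mult[OF conj_poly.const[of "-1"] assms(2)]] by simp

lemma conj_poly_sum:
  assumes "finite I" and "\<And>i. i \<in> I \<Longrightarrow> conj_poly (f i)"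
  shows "conj_poly (\<lambda>zs. \<Sum>i\<in>I. f i zs)"
  using assms by (induction I) (auto intro: conj_poly.intros)

lemma conj_poly_fix_head:
  assumes "conj_poly f"
  shows "conj_poly (\<lambda>zs. f (z # zs))"
  using assms
proof induction
  case (var i)
  then show ?case by (cases i) (auto intro: conj_poly.intros)
qed (auto intro: conj_poly.intros)

lemma conj_poly_continuous_head:
  assumes "conj_poly f"
  shows "continuous_on UNIV (\<lambda>z. f (z # zs))"
  using assms
proof induction
  case (var i)
  then show ?case by (cases i) auto
qed (auto intro!: continuous_intros)

text \<open>
  Conjugation is not polynomial in a complex variable, but along a real line it merely conjugates
  the coefficients.
\<close>
lemma conj_poly_on_real_line:
  assumes "conj_poly f"
  shows "\<exists>p. \<forall>t. f ((a + of_real t * b) # zs) = poly p (of_real t)"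
  using assms
proof induction
  case (const c)
  show ?case by (rule exI[of _ "[:c:]"]) simp
next
  case (var i)
  show ?case
  proof (cases i)
    case 0
    then show ?thesis by (intro exI[of _ "[:a, b:]"]) simp
  next
    case (Suc j)
    then show ?thesis by (intro exI[of _ "[:zs ! j:]"]) simp
  qed
next
  case (cnj f)
  then obtain p where "\<forall>t. f ((a + of_real t * b) # zs) = poly p (of_real t)" by blast
  then show ?case by (intro exI[of _ "map_poly cnj p"]) simp
next
  case (add f g)
  then obtain p q where "\<forall>t. f ((a + of_real t * b) # zs) = poly p (of_real t)"
      "\<forall>t. g ((a + of_real t * b) # zs) = poly q (of_real t)" by blast
  then show ?case by (intro exI[of _ "p + q"]) simp
next
  case (mult f g)
  then obtain p q where "\<forall>t. f ((a + of_real t * b) # zs) = poly p (of_real t)"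
      "\<forall>t. g ((a + of_real t * b) # zs) = poly q (of_real t)" by blast
  then show ?case by (intro exI[of _ "p * q"]) simp
qed

lemma conj_poly_AE_on_real_line:
  assumes "conj_poly f" and "f ((a + of_real t0 * b) # zs) \<noteq> 0"
  shows "AE t in (lborel :: real measure). f ((a + of_real t * b) # zs) \<noteq> 0"
proof -
  obtain p where p: "\<forall>t. f ((a + of_real t * b) # zs) = poly p (of_real t)"
    using conj_poly_on_real_line[OF assms(1)] by blast
  with assms(2) have "p \<noteq> 0" by auto
  then have "finite (of_real -` {z. poly p z = 0} :: real set)"
    by (intro finite_vimageI poly_roots_finite) (auto intro: injI)
  then show ?thesis
    unfolding AE_lborel_iff_negligible by (auto simp: p vimage_def intro: negligible_finite)
qed

text \<open>
  Starting from a point where \<open>f\<close> does not vanish, vary the real part and then the imaginary part: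
  each time only finitely many values are lost.
\<close>
lemma conj_poly_AE_head:
  assumes "conj_poly f" and "f (z0 # zs) \<noteq> 0"
  shows "AE z in lborel. f (z # zs) \<noteq> 0"
proof -
  let ?c = "\<lambda>w :: real \<times> real. Complex (fst w) (snd w)"
  have c_cont: "continuous_on UNIV ?c"
    unfolding Complex_eq by (intro continuous_intros)
  have "AE u in lborel. f (Complex u (Im z0) # zs) \<noteq> 0"
    using conj_poly_AE_on_real_line[OF assms(1), of "\<i> * of_real (Im z0)" "Re z0" 1 zs] assms(2)
    by (simp add: complex_eq[symmetric] Complex_eq add.commute mult.commute)
  then have "AE u in lborel. AE v in lborel. f (Complex u v # zs) \<noteq> 0"
  proof (rule eventually_mono)
    fix u assume "f (Complex u (Im z0) # zs) \<noteq> 0"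
    then show "AE v in lborel. f (Complex u v # zs) \<noteq> 0"
      using conj_poly_AE_on_real_line[OF assms(1), of "of_real u" "Im z0" \<i> zs]
      by (simp add: Complex_eq mult.commute)
  qed
  moreover have "{w \<in> space (lborel \<Otimes>\<^sub>M lborel). f (?c w # zs) \<noteq> 0} \<in> sets (lborel \<Otimes>\<^sub>M lborel)"
  proof -
    have "open {w. f (?c w # zs) \<noteq> 0}"
      by (intro open_Collect_neq continuous_on_compose2[OF conj_poly_continuous_head[OF assms(1)] c_cont])
        (auto intro: continuous_intros)
    then show ?thesis unfolding lborel_prod by simp
  qed
  ultimately have "AE w in lborel \<Otimes>\<^sub>M lborel. f (?c w # zs) \<noteq> 0"
    using lborel_pair.AE_pair_iff[of "\<lambda>u v. f (Complex u v # zs) \<noteq> 0"] by (simp add: split_def)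
  then have "AE w in lborel. f (?c w # zs) \<noteq> 0"
    unfolding lborel_prod .
  then show ?thesis
  proof (rule AE_lborel_surj_image[where f = ?c, rotated -1])
    show "?c differentiable_on UNIV"
      unfolding Complex_eq differentiable_on_def differentiable_def
      by (auto intro!: derivative_eq_intros)
    show "surj ?c"
      by (rule surjI[where f = "\<lambda>z. (Re z, Im z)"]) simp
  qed simp
qed

text \<open>
  A point of nonvanishing persists through the quantifiers: for almost every first entry, the
  remaining entries of the given point still witness that \<open>f\<close> does not vanish identically in the
  other variables.
\<close>
lemma ae_list_conj_poly_nonzero:
  assumes "conj_poly f" and "f zs0 \<noteq> 0" and "length zs0 = n"
  shows "ae_list n (\<lambda>zs. f zs \<noteq> 0)"
  using assms
proof (induction n arbitrary: f zs0)
  case (Suc n)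
  then obtain z0 zs1 where zs0: "zs0 = z0 # zs1" "length zs1 = n"
    by (cases zs0) auto
  then have "AE z in lborel. f (z # zs1) \<noteq> 0"
    using Suc.prems by (intro conj_poly_AE_head[of f z0]) auto
  then have "AE z in lborel. ae_list n (\<lambda>zs. f (z # zs) \<noteq> 0)"
    by (rule eventually_mono) (use Suc.IH[OF conj_poly_fix_head[OF Suc.prems(1)] _ zs0(2)] in blast)
  then show ?case by simp
qed simp

section \<open>Polynomials with the same modulus on the unit circle\<close>

text \<open>
  The two linear factors agree in modulus on the unit circle; the flag selects the reflected one,
  whose root \<open>cnj b\<close> is the mirror image of \<open>1 / b\<close>.  With constant coefficient \<open>1\<close> in the
  unreflected factor, multiplication by it acts on the coefficients from the lowest one upwards.
\<close>
definition root_factor :: "bool \<Rightarrow> complex \<Rightarrow> complex poly" where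
  "root_factor r b = (if r then [:- cnj b, 1:] else [:1, - b:])"

definition reflected_prod :: "nat set \<Rightarrow> complex list \<Rightarrow> complex poly" where
  "reflected_prod J bs = (\<Prod>i<length bs. root_factor (i \<in> J) (bs ! i))"

lemma reflected_prod_Nil [simp]: "reflected_prod J [] = 1"
  by (simp add: reflected_prod_def)

lemma reflected_prod_Cons:
  "reflected_prod J (b # bs) = root_factor (0 \<in> J) b * reflected_prod {i. Suc i \<in> J} bs"
  by (simp add: reflected_prod_def prod.lessThan_Suc_shift del: prod.lessThan_Suc)

lemma degree_root_factor: "degree (root_factor r b) \<le> 1"
  by (simp add: root_factor_def)

lemma degree_reflected_prod: "degree (reflected_prod J bs) \<le> length bs"
proof (induction bs arbitrary: J)
  case (Cons b bs)
  show ?case unfolding reflected_prod_Cons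
    using degree_mult_le[of "root_factor (0 \<in> J) b" "reflected_prod {i. Suc i \<in> J} bs"]
      degree_root_factor[of "0 \<in> J" b] Cons.IH[of "{i. Suc i \<in> J}"] by simp
qed simp

lemma coeff_reflected_prod_empty_nonzero:
  assumes "\<forall>b\<in>set bs. b \<noteq> 0"
  shows "coeff (reflected_prod {} bs) (length bs) \<noteq> 0"
  using assms
proof (induction bs)
  case (Cons b bs)
  have "coeff (reflected_prod {} bs) (Suc (length bs)) = 0"
    by (intro coeff_eq_0 le_imp_less_Suc degree_reflected_prod)
  then show ?case
    using Cons by (simp add: reflected_prod_Cons root_factor_def)
qed simp

lemma conj_poly_coeff_prod_root_factor:
  assumes "finite I"
  shows "conj_poly (\<lambda>zs. coeff (\<Prod>i\<in>I. root_factor (r i) (zs ! i)) k)"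
  using assms
proof (induction I arbitrary: k)
  case empty
  then show ?case by (auto intro: conj_poly.intros)
next
  case (insert i I)
  have root_factor: "conj_poly (\<lambda>zs. coeff (root_factor (r i) (zs ! i)) j)" for j
    unfolding root_factor_def
    using conj_poly_diff[OF conj_poly.const[of 0] conj_poly.var[of i]]
      conj_poly_diff[OF conj_poly.const[of 0] conj_poly.cnj[OF conj_poly.var[of i]]]
    by (cases "r i"; cases j; cases "j - 1") (auto intro: conj_poly.intros)
  show ?case
    using insert.hyps
    by (simp add: coeff_mult, intro conj_poly_sum conj_poly.mult root_factor insert.IH) simp_all
qed

text \<open>
  On the circle \<open>inverse (cnj w) = w\<close>, so both sides are squared moduli there.  After multiplication
  by \<open>w ^ n\<close> both sides become polynomials in \<open>w\<close>, and these agree at infinitely many points.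
\<close>
lemma poly_circle_reflection:
  assumes "degree p \<le> n" and "degree q \<le> n"
    and circle: "\<And>z. norm z = 1 \<Longrightarrow> norm (poly p z) = norm (poly q z)"
    and "w \<noteq> 0"
  shows "poly p w * cnj (poly p (inverse (cnj w))) = poly q w * cnj (poly q (inverse (cnj w)))"
proof -
  \<comment> \<open>The conjugate reversal of \<open>f\<close>, regarded as a polynomial of formal degree \<open>n\<close>.\<close>
  define rev where "rev f = reflect_poly (map_poly cnj f) * monom 1 (n - degree (map_poly cnj f))"
    for f :: "complex poly"
  have rev: "poly (rev f) z = z ^ n * cnj (poly f (inverse (cnj z)))" if "degree f \<le> n" "z \<noteq> 0" for f z
  proof -
    have "degree (map_poly cnj f) \<le> n"
      using that(1) by (simp add: degree_map_poly)
    then show ?thesis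
      using that(2) by (simp add: rev_def poly_reflect_poly_nz poly_monom power_add[symmetric])
  qed
  have inv: "inverse (cnj z) = z" "z \<noteq> 0" if "norm z = 1" for z :: complex
    using that complex_norm_square[of z] by (auto intro: inverse_unique simp: mult.commute)
  define D where "D = p * rev p - q * rev q"
  have "poly D z = 0" if z: "norm z = 1" for z
  proof -
    have "poly p z * cnj (poly p z) = poly q z * cnj (poly q z)"
      using circle[OF z] by (metis complex_norm_square)
    then have "z ^ n * (poly p z * cnj (poly p z)) = z ^ n * (poly q z * cnj (poly q z))"
      by simp
    then show ?thesis
      using rev[OF assms(1) inv(2)[OF z]] rev[OF assms(2) inv(2)[OF z]] inv(1)[OF z]
      by (simp add: D_def mult_ac)
  qed
  then have "sphere 0 1 \<subseteq> {z. poly D z = 0}" by auto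
  moreover have "infinite (sphere (0 :: complex) 1)"
  proof
    assume "finite (sphere (0 :: complex) 1)"
    then have "\<exists>a. sphere (0 :: complex) 1 \<subseteq> {a}"
      using connected_finite_iff_sing[OF connected_sphere, of "0 :: complex" 1] by auto
    moreover have "1 \<in> sphere (0 :: complex) 1" "- 1 \<in> sphere (0 :: complex) 1" by auto
    ultimately show False by (metis one_neq_neg_one singletonD subsetD)
  qed
  ultimately have "D = 0"
    using poly_roots_finite[of D] finite_subset by blast
  then have "poly (p * rev p) w = poly (q * rev q) w"
    by (simp add: D_def)
  then show ?thesis
    using \<open>w \<noteq> 0\<close> by (simp add: rev[OF assms(1)] rev[OF assms(2)])
qed

lemma norm_root_factor_circle:
  assumes "norm z = 1"
  shows "norm (poly (root_factor r b) z) = norm (1 - b * z)"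
proof -
  have "norm (z - cnj b) = norm (cnj z - b)"
    by (metis complex_cnj_cnj complex_cnj_diff complex_mod_cnj)
  also have "\<dots> = norm (z * (cnj z - b))"
    using assms by (simp add: norm_mult)
  also have "z * (cnj z - b) = 1 - b * z"
    using complex_norm_square[of z] assms by (simp add: algebra_simps)
  finally show ?thesis
    by (simp add: root_factor_def algebra_simps)
qed

lemma root_factor_dvd:
  assumes "poly (root_factor r b) w = 0" and "poly p w = 0" and "b \<noteq> 0"
  shows "root_factor r b dvd p"
proof -
  have "\<exists>a. a \<noteq> 0 \<and> root_factor r b = smult a [:- w, 1:]"
    using assms(1,3) by (intro exI[of _ "if r then 1 else - b"]) (auto simp: root_factor_def algebra_simps)
  then show ?thesis
    using assms(2) by (metis poly_eq_0_iff_dvd smult_dvd_iff)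
qed

text \<open>
  By the reflection identity, the zero \<open>1 / b\<close> of the given product is a zero of \<open>p\<close> or the mirror
  image of one.  Accordingly \<open>p\<close> is divisible by one of the two factors belonging to \<open>b\<close>, which can
  be cancelled on the circle because \<open>b\<close> is off the circle.
\<close>
lemma reflected_prod_of_circle_norm:
  assumes "\<And>b. b \<in> set bs \<Longrightarrow> b \<noteq> 0 \<and> norm b \<noteq> 1" and "degree p \<le> length bs"
    and "\<And>z. norm z = 1 \<Longrightarrow> norm (poly p z) = norm (c * poly (reflected_prod {} bs) z)"
  shows "\<exists>d J. J \<subseteq> {..<length bs} \<and> norm d = norm c \<and> p = smult d (reflected_prod J bs)"
  using assms
proof (induction bs arbitrary: p)
  case Nil
  then obtain d where "p = [:d:]" by (auto elim: degree_eq_zeroE)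
  with Nil(3)[of 1] show ?case by (auto intro!: exI[of _ d])
next
  case (Cons b bs)
  let ?q = "smult c (reflected_prod {} (b # bs))"
  have b: "b \<noteq> 0" "norm b \<noteq> 1" using Cons.prems(1)[of b] by auto
  have "poly ?q (inverse b) = 0"
    using b by (simp add: reflected_prod_Cons root_factor_def)
  moreover have "degree ?q \<le> length (b # bs)"
    using degree_smult_le degree_reflected_prod order_trans by blast
  ultimately have "poly p (inverse b) * cnj (poly p (cnj b)) = 0"
    using poly_circle_reflection[of p "length (b # bs)" ?q "inverse b"] Cons.prems(2,3) b
    by simp
  then consider "poly p (inverse b) = 0" | "poly p (cnj b) = 0" by auto
  then obtain r where "root_factor r b dvd p"
  proof cases
    case 1
    then have "root_factor False b dvd p"
      using b by (intro root_factor_dvd[of _ _ "inverse b"]) (auto simp: root_factor_def)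
    then show ?thesis by (rule that)
  next
    case 2
    then have "root_factor True b dvd p"
      using b by (intro root_factor_dvd[of _ _ "cnj b"]) (auto simp: root_factor_def)
    then show ?thesis by (rule that)
  qed
  then obtain q where p: "p = root_factor r b * q" by auto
  have "degree q \<le> length bs"
  proof (cases "q = 0")
    case False
    have "degree (root_factor r b) = 1" using b by (simp add: root_factor_def)
    moreover from this have "root_factor r b \<noteq> 0" by auto
    ultimately show ?thesis using Cons.prems(2) False by (simp add: p degree_mult_eq)
  qed simp
  moreover have "norm (poly q z) = norm (c * poly (reflected_prod {} bs) z)" if z: "norm z = 1" for z
  proof -
    have "1 - b * z \<noteq> 0" using b z by (metis eq_iff_diff_eq_0 mult.right_neutral norm_mult norm_one)
    moreover have "norm (1 - b * z) * norm (poly q z)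
        = norm (1 - b * z) * norm (c * poly (reflected_prod {} bs) z)"
      using Cons.prems(3)[OF z] norm_root_factor_circle[OF z, of _ b]
      by (simp add: p reflected_prod_Cons norm_mult mult_ac)
    ultimately show ?thesis by simp
  qed
  ultimately obtain d J where J: "J \<subseteq> {..<length bs}" "norm d = norm c" "q = smult d (reflected_prod J bs)"
    using Cons.IH[of q] Cons.prems(1) by auto
  let ?J = "Suc ` J \<union> (if r then {0} else {})"
  have "{i. Suc i \<in> ?J} = J" "0 \<in> ?J \<longleftrightarrow> r" by auto
  then have "p = smult d (reflected_prod ?J (b # bs))"
    by (simp add: reflected_prod_Cons p J(3))
  moreover have "?J \<subseteq> {..<length (b # bs)}" using J(1) by auto
  ultimately show ?case using J(2) by blast
qed

section \<open>Generic phases of the coefficients\<close>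

text \<open>
  Let \<open>y\<close> and \<open>x\<close> be the coefficients of \<open>smult d p\<close> and \<open>smult c q\<close>.  If \<open>y n * cnj (x n)\<close> and
  \<open>y k * cnj (x k)\<close> are both real, then so is the product of the conjugate of the former with the
  latter.  That product is \<open>phase_product J k bs\<close> times the nonnegative real \<open>\<bar>c d\<bar>\<^sup>2\<close>, so the unknown
  constants drop out.
\<close>
definition phase_product :: "nat set \<Rightarrow> nat \<Rightarrow> complex list \<Rightarrow> complex" where
  "phase_product J k bs = (let n = length bs; p = reflected_prod J bs; q = reflected_prod {} bs in
     cnj (coeff p n) * coeff q n * coeff p k * cnj (coeff q k))"

text \<open>
  The factor \<open>1 + z\<close> for \<open>b = -1\<close> is its own reflection, so the entries other than \<open>j\<close> do not depend
  on \<open>J\<close>.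
\<close>
lemma reflected_prod_witness:
  assumes "j < n"
  shows "reflected_prod J ((replicate n (- 1))[j := b]) = root_factor (j \<in> J) b * [:1, 1:] ^ (n - 1)"
proof -
  have "reflected_prod J ((replicate n (- 1))[j := b])
      = root_factor (j \<in> J) b * (\<Prod>i\<in>{..<n} - {j}. root_factor (i \<in> J) ((replicate n (- 1))[j := b] ! i))"
    using assms by (simp add: reflected_prod_def prod.remove[of _ j])
  also have "(\<Prod>i\<in>{..<n} - {j}. root_factor (i \<in> J) ((replicate n (- 1))[j := b] ! i)) = (\<Prod>i\<in>{..<n} - {j}. [:1, 1:])"
    by (intro prod.cong) (auto simp: root_factor_def)
  finally show ?thesis using assms by simp
qed

text \<open>
  Both polynomials have the form \<open>(1 + z) ^ (n - 1)\<close> times a linear factor, and the imaginary part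
  comes out as a multiple of the product of two neighbouring binomial coefficients, which are positive
  because \<open>0 < k < n\<close>.
\<close>
lemma phase_product_witness:
  assumes "1 \<le> k" "k < n" "j < n" "j \<in> J"
  shows "Im (phase_product J k ((replicate n (- 1))[j := - 2 * \<i>])) \<noteq> 0"
proof -
  define A where "A = real (n - 1 choose k)"
  define B where "B = real (n - 1 choose (k - 1))"
  obtain k' where k': "k = Suc k'" using assms(1) by (cases k) auto
  obtain m where m: "n = Suc m" using assms(2) by (cases n) auto
  have pow: "coeff ([:1, 1:] ^ m :: complex poly) i = of_nat (m choose i)" for i
  proof (cases "i \<le> m")
    case False
    have "degree ([:1, 1:] ^ m :: complex poly) \<le> m"
      using degree_power_le[of "[:1, 1:] :: complex poly" m] by simp
    then have "coeff ([:1, 1:] ^ m :: complex poly) i = 0"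
      using False by (intro coeff_eq_0) simp
    then show ?thesis using False by (simp add: binomial_eq_0)
  qed (simp add: coeff_linear_poly_power)
  have AB: "A > 0" "B > 0"
    using assms(1,2) by (auto simp: A_def B_def)
  let ?bs = "(replicate n (- 1))[j := - 2 * \<i>]"
  have lin: "coeff ([:v, u:] * [:1, 1:] ^ m) (Suc i) = v * of_nat (m choose Suc i) + u * of_nat (m choose i)"
    for u v :: complex and i
    by (simp add: pow)
  have kn: "of_nat (m choose Suc k') = complex_of_real A" "of_nat (m choose k') = complex_of_real B"
    by (simp_all add: A_def B_def k' m)
  have J: "reflected_prod J ?bs = [:- 2 * \<i>, 1:] * [:1, 1:] ^ m"
    and no_J: "reflected_prod {} ?bs = [:1, 2 * \<i>:] * [:1, 1:] ^ m"
    using assms by (simp_all only: reflected_prod_witness m) (simp_all add: root_factor_def)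
  have "coeff (reflected_prod J ?bs) n = 1" "coeff (reflected_prod {} ?bs) n = 2 * \<i>"
    and "coeff (reflected_prod J ?bs) k = B - 2 * \<i> * A" "coeff (reflected_prod {} ?bs) k = A + 2 * \<i> * B"
    unfolding J no_J unfolding k' m lin kn by simp_all
  then have "phase_product J k ?bs = 2 * \<i> * (B - 2 * \<i> * A) * (A - 2 * \<i> * B)"
    by (simp add: phase_product_def Let_def)
  moreover have "Im (2 * \<i> * (B - 2 * \<i> * A) * (A - 2 * \<i> * B)) = - 6 * (A * B)"
    by (simp add: algebra_simps)
  ultimately show ?thesis using AB by simp
qed

lemma ae_list_phase_product:
  assumes "1 \<le> k" "k < n" "J \<subseteq> {..<n}" "J \<noteq> {}"
  shows "ae_list n (\<lambda>bs. Im (phase_product J k bs) \<noteq> 0)"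
proof -
  define f where "f r i bs = coeff (\<Prod>j<n. root_factor (j \<in> r) (bs ! j)) i" for r i and bs :: "complex list"
  define g where "g bs = cnj (f J n bs) * f {} n bs * f J k bs * cnj (f {} k bs)" for bs
  have g: "g bs = phase_product J k bs" if "length bs = n" for bs
    using that by (simp add: g_def f_def phase_product_def reflected_prod_def Let_def)
  \<comment> \<open>The imaginary part, rewritten as a polynomial in the entries and their conjugates.\<close>
  have Im: "g bs - cnj (g bs) \<noteq> 0 \<longleftrightarrow> Im (g bs) \<noteq> 0" for bs
    by (simp add: complex_eq_iff)
  have "conj_poly (f r i)" for r i
    unfolding f_def[abs_def] by (rule conj_poly_coeff_prod_root_factor) simp
  then have "conj_poly (\<lambda>bs. g bs - cnj (g bs))"
    unfolding g_def by (intro conj_poly_diff conj_poly.intros)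
  moreover obtain j where j: "j \<in> J" "j < n" using assms(3,4) by auto
  let ?ws = "(replicate n (- 1))[j := - 2 * \<i>]"
  have "g ?ws - cnj (g ?ws) \<noteq> 0"
    unfolding Im using phase_product_witness[OF assms(1,2) j(2,1)] by (simp add: g)
  ultimately have "ae_list n (\<lambda>bs. g bs - cnj (g bs) \<noteq> 0)"
    by (rule ae_list_conj_poly_nonzero) simp
  then have "ae_list n (\<lambda>bs. Im (g bs) \<noteq> 0)"
    unfolding Im .
  then show ?thesis
    by (rule ae_list_mono) (simp add: g)
qed

lemma AE_nonzero_off_circle: "AE b in lborel. b \<noteq> 0 \<and> norm (b :: complex) \<noteq> 1"
proof -
  have "negligible ({0} \<union> sphere (0 :: complex) 1)"
    by (intro negligible_Un negligible_sphere) simp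
  moreover have "{b :: complex. \<not> (b \<noteq> 0 \<and> norm b \<noteq> 1)} = {0} \<union> sphere 0 1"
    by auto
  ultimately show ?thesis by (simp only: AE_lborel_iff_negligible)
qed

section \<open>From roots to coefficients\<close>

interpretation complex_product: product_sigma_finite "\<lambda>_::nat. lborel :: complex measure" ..

abbreviation complex_coords :: "nat \<Rightarrow> (nat \<Rightarrow> complex) measure" where
  "complex_coords n \<equiv> PiM {..<n} (\<lambda>_. lborel)"

lemma AE_complex_coords_Suc:
  assumes "Measurable.pred (complex_coords (Suc n)) P"
  shows "(AE x in complex_coords (Suc n). P x) \<longleftrightarrow>
           (AE x in complex_coords n. AE t in lborel. P (x(n := t)))"
    and "Measurable.pred (complex_coords n) (\<lambda>x. AE t in lborel. P (x(n := t)))"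
  using complex_product.AE_PiM_insert[of "{..<n}" n P] assms unfolding lessThan_Suc by auto

lemma AE_complex_coords_nonzero:
  "AE a in complex_coords (Suc n). a 0 \<noteq> 0"
proof (induction n)
  case 0
  have "AE t in lborel. t \<noteq> (0::complex)"
    by (simp add: AE_lborel_iff_negligible)
  then show ?case by (subst AE_complex_coords_Suc(1)) simp_all
next
  case (Suc n)
  then have "AE a in complex_coords (Suc n). AE t in lborel. (a(Suc n := t)) 0 \<noteq> 0"
    by (rule eventually_mono) simp
  then show ?case by (subst AE_complex_coords_Suc(1)) simp_all
qed

text \<open>
  The first \<open>n\<close> coefficients of \<open>(1 - b z) q\<close>.
\<close>
definition shear :: "complex \<Rightarrow> nat \<Rightarrow> (nat \<Rightarrow> complex) \<Rightarrow> nat \<Rightarrow> complex" where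
  "shear b n q = (\<lambda>i\<in>{..<n}. q i - (if i = 0 then 0 else b * q (i - 1)))"

text \<open>
  The map is unipotent and triangular: given the earlier coordinates, each coordinate is only
  translated.
\<close>
lemma AE_shear:
  assumes "Measurable.pred (complex_coords n) R"
    and "AE q in complex_coords n. R (shear b n q)"
  shows "AE a in complex_coords n. R a"
  using assms
proof (induction n arbitrary: R)
  case 0
  have "shear b 0 q = q" if "q \<in> space (complex_coords 0)" for q
    using that by (auto simp: shear_def space_PiM)
  then show ?case using "0.prems"(2) by (auto simp: AE_iff_measurable)
next
  case (Suc n)
  let ?R = "\<lambda>a. AE t in lborel. R (a(n := t))"
  have [measurable]: "shear b (Suc n) \<in> measurable (complex_coords (Suc n)) (complex_coords (Suc n))"
    unfolding shear_def by (intro measurable_restrict) simp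
  have Rs: "Measurable.pred (complex_coords (Suc n)) (\<lambda>q. R (shear b (Suc n) q))"
    using Suc.prems(1) by measurable
  have shear_upd: "shear b (Suc n) (q(n := t)) = (shear b n q)(n := - (if n = 0 then 0 else b * q (n - 1)) + t)"
    for q t by (auto simp: shear_def fun_eq_iff restrict_def)
  have "AE q in complex_coords n. AE t in lborel. R (shear b (Suc n) (q(n := t)))"
    using Suc.prems(2) AE_complex_coords_Suc(1)[OF Rs] by simp
  then have "AE q in complex_coords n. ?R (shear b n q)"
    unfolding shear_upd by (rule eventually_mono) (rule AE_lborel_translation)
  then have "AE a in complex_coords n. ?R a"
    by (rule Suc.IH[OF AE_complex_coords_Suc(2)[OF Suc.prems(1)]])
  then show ?case
    using AE_complex_coords_Suc(1)[OF Suc.prems(1)] by blast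
qed

lemma coeff_linear_times:
  "coeff ([:1, - b:] * p) i = coeff p i - (if i = 0 then 0 else b * coeff p (i - 1))"
  for b :: complex
  by (cases i) simp_all

text \<open>
  Horner's scheme, that is, division of the sheared coefficients by \<open>1 - b z\<close>.
\<close>
lemma shear_horner:
  assumes "j < n"
  shows "q j = (\<Sum>i\<le>j. shear b n q i * b ^ (j - i))"
  using assms
proof (induction j)
  case 0
  then show ?case by (simp add: shear_def)
next
  case (Suc j)
  have "(\<Sum>i\<le>Suc j. shear b n q i * b ^ (Suc j - i))
      = b * (\<Sum>i\<le>j. shear b n q i * b ^ (j - i)) + shear b n q (Suc j)"
    by (simp add: sum_distrib_left Suc_diff_le mult_ac)
  also have "\<dots> = q (Suc j)"
    using Suc by (simp add: shear_def)
  finally show ?case ..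
qed

text \<open>
  In the induction step, the first \<open>n + 1\<close> coefficients \<open>a\<close> of \<open>(1 - b z) q\<close> range over almost all
  vectors when \<open>q\<close> does, for fixed \<open>b\<close>.  Once \<open>b\<close> is quantified innermost, the last coefficient is,
  by Horner's scheme, a polynomial in \<open>b\<close> of degree \<open>n + 1\<close> with leading coefficient \<open>- a 0\<close>.
\<close>
lemma AE_coeffs_from_roots:
  assumes "Measurable.pred (complex_coords (Suc n)) R"
    and "ae_list n (\<lambda>bs. AE c in lborel. R (\<lambda>i\<in>{..<Suc n}. c * coeff (reflected_prod {} bs) i))"
  shows "AE a in complex_coords (Suc n). R a"
  using assms
proof (induction n arbitrary: R)
  case 0
  have eq: "x(0 := c) = (\<lambda>i\<in>{..<Suc 0}. c * coeff (reflected_prod {} []) i)"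
    if "x \<in> space (complex_coords 0)" for x c
    using that by (auto simp: space_PiM fun_eq_iff)
  have "AE x in complex_coords 0. AE c in lborel. R (x(0 := c))"
  proof (rule AE_I2)
    fix x assume "x \<in> space (complex_coords 0)"
    from 0(2)[unfolded ae_list.simps] show "AE c in lborel. R (x(0 := c))"
      unfolding eq[OF \<open>x \<in> space (complex_coords 0)\<close>] .
  qed
  then show ?case
    using AE_complex_coords_Suc(1)[OF 0(1)] by blast
next
  case (Suc n)
  interpret pair_sigma_finite "lborel :: complex measure" "complex_coords (Suc n)"
    by (intro pair_sigma_finite.intro complex_product.sigma_finite lborel.sigma_finite_measure_axioms) simp
  note [measurable] = Suc.prems(1)
  \<comment> \<open>Coefficient \<open>n + 1\<close> of \<open>(1 - b z) q\<close> in terms of its lower coefficients \<open>a\<close>.\<close>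
  define last where "last b a = - (\<Sum>i\<le>n. a i * b ^ (Suc n - i))" for b :: complex and a
  have upd: "(\<lambda>x. (snd x)(Suc n := last (fst x) (snd x)))
      \<in> measurable (lborel \<Otimes>\<^sub>M complex_coords (Suc n)) (complex_coords (Suc (Suc n)))"
  proof (rule measurable_fun_upd[where J = "{..<Suc n}"])
    show "(\<lambda>x. last (fst x) (snd x)) \<in> measurable (lborel \<Otimes>\<^sub>M complex_coords (Suc n)) lborel"
      unfolding last_def by measurable
  qed auto
  \<comment> \<open>Joint measurability, for the interchange of \<open>b\<close> with the coefficients.\<close>
  have R2: "Measurable.pred (lborel \<Otimes>\<^sub>M complex_coords (Suc n))
      (\<lambda>x. R ((snd x)(Suc n := last (fst x) (snd x))))"
    using upd by measurable
  have "AE b in lborel. ae_list n (\<lambda>bs. AE c in lborel.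
      R (\<lambda>i\<in>{..<Suc (Suc n)}. c * coeff (reflected_prod {} (b # bs)) i))"
    using Suc.prems(2)[unfolded ae_list.simps] .
  then have "AE b in lborel. AE a in complex_coords (Suc n). R (a(Suc n := last b a))"
  proof (rule eventually_mono)
    fix b
    assume b: "ae_list n (\<lambda>bs. AE c in lborel.
      R (\<lambda>i\<in>{..<Suc (Suc n)}. c * coeff (reflected_prod {} (b # bs)) i))"
    let ?mul = "\<lambda>q. (shear b (Suc n) q)(Suc n := last b (shear b (Suc n) q))"
    have upd_b: "(\<lambda>a. a(Suc n := last b a)) \<in> measurable (complex_coords (Suc n)) (complex_coords (Suc (Suc n)))"
      using measurable_compose[OF measurable_Pair1' upd, of b] by simp
    have [measurable]: "shear b (Suc n) \<in> measurable (complex_coords (Suc n)) (complex_coords (Suc n))"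
      unfolding shear_def by (intro measurable_restrict) simp
    have Rb: "Measurable.pred (complex_coords (Suc n)) (\<lambda>a. R (a(Suc n := last b a)))"
      using upd_b by measurable
    have Rmul: "Measurable.pred (complex_coords (Suc n)) (\<lambda>q. R (?mul q))"
      using Rb by measurable
    have last_shear: "last b (shear b (Suc n) q) = - b * q n" for q
    proof -
      have "(\<Sum>i\<le>n. a i * b ^ (Suc n - i)) = b * (\<Sum>i\<le>n. a i * b ^ (n - i))" for a :: "nat \<Rightarrow> complex"
        by (simp add: sum_distrib_left Suc_diff_le mult_ac)
      then show ?thesis
        using shear_horner[of n "Suc n" q b] by (simp add: last_def)
    qed
    \<comment> \<open>Multiplication by \<open>1 - b z\<close>, with the last coefficient expressed by the others.\<close>
    have mul: "(\<lambda>i\<in>{..<Suc (Suc n)}. c * coeff (reflected_prod {} (b # bs)) i)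
        = ?mul (\<lambda>i\<in>{..<Suc n}. c * coeff (reflected_prod {} bs) i)" if "length bs = n" for c bs
    proof -
      have top: "coeff (reflected_prod {} bs) (Suc n) = 0"
        using degree_reflected_prod[of "{}" bs] that by (intro coeff_eq_0) simp
      have cf: "coeff (reflected_prod {} (b # bs)) i
          = coeff (reflected_prod {} bs) i - (if i = 0 then 0 else b * coeff (reflected_prod {} bs) (i - 1))" for i
        unfolding reflected_prod_Cons root_factor_def by (simp only: empty_iff if_False Collect_empty_eq coeff_linear_times) simp
      from top show ?thesis
        unfolding last_shear
        by (auto simp: fun_eq_iff cf shear_def less_Suc_eq right_diff_distrib mult_ac)
    qed
    have "ae_list n (\<lambda>bs. AE c in lborel. R (?mul (\<lambda>i\<in>{..<Suc n}. c * coeff (reflected_prod {} bs) i)))"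
      using b by (rule ae_list_mono) (simp add: mul)
    from Suc.IH[OF Rmul this] show "AE a in complex_coords (Suc n). R (a(Suc n := last b a))"
      by (rule AE_shear[OF Rb])
  qed
  then have "AE a in complex_coords (Suc n). AE b in lborel. R (a(Suc n := last b a))"
    using R2 by (subst (asm) AE_commute) (auto simp: pred_def)
  with AE_complex_coords_nonzero[of n]
  have "AE a in complex_coords (Suc n). AE t in lborel. R (a(Suc n := t))"
  proof eventually_elim
    case (elim a)
    define p where "p = - (\<Sum>i\<le>n. monom (a i) (Suc n - i))"
    have "poly p b = last b a" for b
      by (simp add: p_def last_def poly_sum poly_monom)
    moreover have "coeff p (Suc n) = - a 0"
    proof -
      have "(\<Sum>i\<le>n. if Suc n - i = Suc n then a i else 0) = (\<Sum>i\<le>n. if i = 0 then a i else 0)"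
        by (intro sum.cong) auto
      then show ?thesis by (simp add: p_def coeff_sum)
    qed
    ultimately show ?case
      using elim le_degree[of p "Suc n"]
      by (intro AE_polynomial_image[where p = p and S = "\<lambda>t. R (a(Suc n := t))"]) auto
  qed
  then show ?case
    using AE_complex_coords_Suc(1)[OF Suc.prems(1)] by blast
qed

section \<open>Measurability of the set of ambiguous signals\<close>

text \<open>
  Agreement of phases is replaced by the closed condition that \<open>y i * cnj (a i)\<close> is a nonnegative
  real, and the endpoints of \<open>y\<close> are allowed to vanish.  Both changes make the set of ambiguous
  vectors a countable union of projections of compact sets, and neither shrinks it.
\<close>
definition ambiguous :: "nat \<Rightarrow> nat \<Rightarrow> (nat \<Rightarrow> complex) \<Rightarrow> bool" where
  "ambiguous n k a \<longleftrightarrow> (\<exists>y. (\<exists>i\<le>n. y i \<noteq> a i) \<and>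
     (\<forall>\<theta>. norm (\<Sum>i\<le>n. y i * cis \<theta> ^ i) = norm (\<Sum>i\<le>n. a i * cis \<theta> ^ i)) \<and>
     (\<forall>i\<in>{n, k}. Im (y i * cnj (a i)) = 0 \<and> 0 \<le> Re (y i * cnj (a i))))"

lemma ambiguous_cong:
  assumes "k \<le> n" and "\<And>i. i \<le> n \<Longrightarrow> a i = b i"
  shows "ambiguous n k a \<longleftrightarrow> ambiguous n k b"
  using assms by (simp add: ambiguous_def cong: conj_cong)

lemma compact_function_cball: "compact (Pi\<^sub>E UNIV (\<lambda>_. cball 0 r) :: ('i \<Rightarrow> complex) set)"
  using compactin_PiE[of "\<lambda>_ :: 'i. euclidean :: complex topology" UNIV "\<lambda>_. cball 0 r"]
  by (simp add: euclidean_product_topology compactin_euclidean_iff)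

text \<open>
  For bounded \<open>a\<close> and \<open>y\<close> that differ in a fixed coordinate by at least a fixed amount, the conditions
  define a compact set of pairs, whose projection is compact.  Countably many bounds suffice.
\<close>
lemma borel_ambiguous:
  assumes "k \<le> n"
  shows "{a. (\<forall>i>n. a i = 0) \<and> ambiguous n k a} \<in> sets borel"
proof -
  define S where "S j m = {(a, y). (\<forall>i>n. a i = 0) \<and> 1 / Suc m \<le> norm (y j - a j) \<and>
     (\<forall>\<theta>. norm (\<Sum>i\<le>n. y i * cis \<theta> ^ i) = norm (\<Sum>i\<le>n. a i * cis \<theta> ^ i)) \<and>
     (\<forall>i\<in>{n, k}. Im (y i * cnj (a i)) = 0 \<and> 0 \<le> Re (y i * cnj (a i)))} \<inter>
     (Pi\<^sub>E UNIV (\<lambda>_. cball 0 m) \<times> Pi\<^sub>E UNIV (\<lambda>_. cball 0 m))"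
    for j m :: nat
  have "closed (fst ` S j m)" for j m
  proof -
    have coord: "continuous_on UNIV (\<lambda>p :: (nat \<Rightarrow> complex) \<times> (nat \<Rightarrow> complex). fst p i)"
      "continuous_on UNIV (\<lambda>p :: (nat \<Rightarrow> complex) \<times> (nat \<Rightarrow> complex). snd p i)" for i
      by (rule continuous_on_product_then_coordinatewise, intro continuous_intros)+
    have "compact (S j m)"
      unfolding S_def split_def Ball_def
      by (intro closed_Int_compact compact_Times compact_function_cball closed_Collect_conj
          closed_Collect_all closed_Collect_le closed_Collect_eq
          closed_Collect_imp open_Collect_const continuous_intros coord)
    then show ?thesis
      by (intro compact_imp_closed compact_continuous_image continuous_intros)
  qed
  then have "(\<Union>j\<in>{..n}. \<Union>m. fst ` S j m) \<in> sets borel"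
    by (intro sets.countable_UN' borel_closed) auto
  also have "(\<Union>j\<in>{..n}. \<Union>m. fst ` S j m) = {a. (\<forall>i>n. a i = 0) \<and> ambiguous n k a}"
  proof (intro equalityI subsetI)
    fix a assume "a \<in> (\<Union>j\<in>{..n}. \<Union>m. fst ` S j m)"
    then obtain j m y where "j \<le> n" and ay: "(a, y) \<in> S j m" by auto
    have "1 / Suc m \<le> norm (y j - a j)" using ay by (auto simp: S_def)
    then have "y j \<noteq> a j" by (auto simp: divide_le_0_iff)
    then show "a \<in> {a. (\<forall>i>n. a i = 0) \<and> ambiguous n k a}"
      using ay \<open>j \<le> n\<close> by (auto simp: ambiguous_def S_def)
  next
    fix a assume "a \<in> {a. (\<forall>i>n. a i = 0) \<and> ambiguous n k a}"
    then obtain y j where a: "\<forall>i>n. a i = 0" and j: "j \<le> n" "y j \<noteq> a j"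
      and y: "\<forall>\<theta>. norm (\<Sum>i\<le>n. y i * cis \<theta> ^ i) = norm (\<Sum>i\<le>n. a i * cis \<theta> ^ i)"
        "\<forall>i\<in>{n, k}. Im (y i * cnj (a i)) = 0 \<and> 0 \<le> Re (y i * cnj (a i))"
      by (auto simp: ambiguous_def)
    \<comment> \<open>Only the values of \<open>y\<close> up to \<open>n\<close> matter, but compactness needs all of them bounded.\<close>
    define y' where "y' i = (if i \<le> n then y i else 0)" for i
    define r where "r = Max (insert (1 / norm (y j - a j)) ((\<lambda>i. norm (a i) + norm (y i)) ` {..n}))"
    obtain m :: nat where m: "r \<le> m" using real_arch_simple by blast
    have "1 / norm (y j - a j) \<le> r" unfolding r_def by (rule Max_ge) auto
    then have "1 \<le> Suc m * norm (y j - a j)"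
      using m j(2) by (simp add: divide_le_eq) (smt (verit) mult_right_mono norm_ge_zero)
    then have sep: "1 / Suc m \<le> norm (y' j - a j)"
      using j(1) by (simp add: y'_def divide_le_eq mult.commute)
    have "norm (a i) + norm (y i) \<le> m" if "i \<le> n" for i
      using m that by (intro order_trans[OF Max_ge m[unfolded r_def]]) auto
    then have bound: "norm (a i) \<le> m \<and> norm (y' i) \<le> m" for i
    proof (cases "i \<le> n")
      case True
      then show ?thesis
        using \<open>\<And>i. i \<le> n \<Longrightarrow> norm (a i) + norm (y i) \<le> m\<close>[of i]
        by (auto simp: y'_def intro: order_trans[of _ "norm (a i) + norm (y i)"])
    qed (use a in \<open>simp add: y'_def\<close>)
    have "(a, y') \<in> S j m"
      using a y sep bound assms by (auto simp: S_def y'_def)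
    then show "a \<in> (\<Union>j\<in>{..n}. \<Union>m. fst ` S j m)"
      using j(1) by force
  qed
  finally show ?thesis .
qed

lemma measurable_ambiguous:
  assumes "k \<le> n"
  shows "Measurable.pred (complex_coords (Suc n)) (ambiguous n k)"
proof -
  let ?ext = "\<lambda>a i. if i \<le> n then a i else 0 :: complex"
  have ext: "?ext \<in> borel_measurable (complex_coords (Suc n))"
  proof (rule measurable_coordinatewise_then_product)
    fix i show "(\<lambda>a. ?ext a i) \<in> borel_measurable (complex_coords (Suc n))"
      by (cases "i \<le> n") simp_all
  qed
  have "Measurable.pred (complex_coords (Suc n)) (\<lambda>a. ?ext a \<in> {a. (\<forall>i>n. a i = 0) \<and> ambiguous n k a})"
    by (rule pred_sets2[OF borel_ambiguous[OF assms] ext])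
  moreover have "?ext a \<in> {a. (\<forall>i>n. a i = 0) \<and> ambiguous n k a} \<longleftrightarrow> ambiguous n k a" for a
    using ambiguous_cong[OF assms, of "?ext a" a] by simp
  ultimately show ?thesis by simp
qed

section \<open>Almost no signal is ambiguous\<close>

text \<open>
  A competitor is a reflected product with some set \<open>J\<close>.  For \<open>J = {}\<close> it is \<open>d / c\<close> times the given
  polynomial, with \<open>\<bar>d\<bar> = \<bar>c\<bar>\<close>, and the phase of coefficient \<open>n\<close> forces \<open>d = c\<close>.  For other \<open>J\<close> the
  two phase conditions would make the phase product real.
\<close>
lemma not_ambiguous_of_roots:
  assumes n: "length bs = n" and "k \<le> n" and "c \<noteq> 0"
    and bs: "\<forall>b\<in>set bs. b \<noteq> 0 \<and> norm b \<noteq> 1"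
    and phase: "\<forall>J\<in>Pow {..<n} - {{}}. Im (phase_product J k bs) \<noteq> 0"
  shows "\<not> ambiguous n k (\<lambda>i\<in>{..<Suc n}. c * coeff (reflected_prod {} bs) i)"
proof
  let ?q = "reflected_prod {} bs"
  assume "ambiguous n k (\<lambda>i\<in>{..<Suc n}. c * coeff ?q i)"
  then have "ambiguous n k (\<lambda>i. c * coeff ?q i)"
    by (subst (asm) ambiguous_cong[OF \<open>k \<le> n\<close>]) auto
  then obtain y where ne: "\<exists>i\<le>n. y i \<noteq> c * coeff ?q i"
    and circle: "\<And>\<theta>. norm (\<Sum>i\<le>n. y i * cis \<theta> ^ i) = norm (\<Sum>i\<le>n. c * coeff ?q i * cis \<theta> ^ i)"
    and real: "\<forall>i\<in>{n, k}. Im (y i * cnj (c * coeff ?q i)) = 0 \<and> 0 \<le> Re (y i * cnj (c * coeff ?q i))"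
    by (auto simp: ambiguous_def)
  define p where "p = (\<Sum>i\<le>n. monom (y i) i)"
  have coeff_p: "coeff p i = y i" if "i \<le> n" for i
    using that by (simp add: p_def coeff_sum)
  have "degree p \<le> length bs"
    unfolding p_def n by (intro degree_sum_le) (auto intro: order_trans[OF degree_monom_le])
  moreover have "norm (poly p z) = norm (c * poly ?q z)" if "norm z = 1" for z
  proof -
    obtain \<theta> where z: "z = cis \<theta>"
      using \<open>norm z = 1\<close> by (metis complex_norm_eq_1_exp cis_conv_exp)
    have "c * poly ?q z = (\<Sum>i\<le>n. c * coeff ?q i * z ^ i)"
      using arg_cong[OF poly_as_sum_of_monoms'[OF degree_reflected_prod[of "{}" bs]], of "\<lambda>r. c * poly r z"] n
      by (simp add: poly_sum poly_monom sum_distrib_left mult.assoc)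
    then show ?thesis
      using circle[of \<theta>] by (simp add: z p_def poly_sum poly_monom)
  qed
  ultimately obtain d J where J: "J \<subseteq> {..<n}" "norm d = norm c" "p = smult d (reflected_prod J bs)"
    using reflected_prod_of_circle_norm[of bs p c] bs n by blast
  have y: "y i = d * coeff (reflected_prod J bs) i" if "i \<le> n" for i
    using coeff_p[OF that] J(3) by simp
  show False
  proof (cases "J = {}")
    case True
    let ?u = "d * cnj c" and ?s = "(norm (coeff ?q n))\<^sup>2"
    have s: "?s > 0"
      using coeff_reflected_prod_empty_nonzero[of bs] bs n by simp
    have "y n * cnj (c * coeff ?q n) = of_real ?s * ?u"
      unfolding complex_norm_square using y[of n] True by (simp add: mult_ac)
    then have "Im (of_real ?s * ?u) = 0" "0 \<le> Re (of_real ?s * ?u)"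
      using bspec[OF real, of n] by (simp_all only: insertI1)
    moreover have "Im (of_real ?s * u) = ?s * Im u" "Re (of_real ?s * u) = ?s * Re u" for u
      by simp_all
    ultimately have "Im ?u = 0" "0 \<le> Re ?u"
      using s by (simp_all only: mult_eq_0_iff zero_le_mult_iff) auto
    then have "?u = of_real (norm ?u)"
      by (simp add: complex_eq_iff cmod_eq_Re)
    also have "\<dots> = c * cnj c"
      using J(2) by (simp add: norm_mult complex_norm_square[symmetric] power2_eq_square)
    finally have "d = c" using \<open>c \<noteq> 0\<close> by simp
    then show False using ne y True by auto
  next
    case False
    have "cnj (y n * cnj (c * coeff ?q n)) * (y k * cnj (c * coeff ?q k))
        = of_real ((norm c)\<^sup>2 * (norm d)\<^sup>2) * phase_product J k bs"
      unfolding of_real_mult complex_norm_square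
      using y[of n] y[OF \<open>k \<le> n\<close>] n by (simp add: phase_product_def Let_def mult_ac)
    moreover have "Im (cnj (y n * cnj (c * coeff ?q n)) * (y k * cnj (c * coeff ?q k))) = 0"
    proof -
      have "Im (cnj u * v) = 0" if "Im u = 0" "Im v = 0" for u v
        using that by simp
      then show ?thesis using real by blast
    qed
    ultimately have "Im (phase_product J k bs) = 0"
      using \<open>c \<noteq> 0\<close> J(2) by auto
    then show False using phase J(1) False by auto
  qed
qed

lemma AE_not_ambiguous:
  assumes "1 \<le> k" and "k < n"
  shows "AE a in complex_coords (Suc n). \<not> ambiguous n k a"
proof (rule AE_coeffs_from_roots)
  show "Measurable.pred (complex_coords (Suc n)) (\<lambda>a. \<not> ambiguous n k a)"
    using measurable_ambiguous[of k n] assms by simp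
  have "ae_list n (\<lambda>bs. (\<forall>b\<in>set bs. b \<noteq> 0 \<and> norm b \<noteq> 1) \<and>
      (\<forall>J\<in>Pow {..<n} - {{}}. Im (phase_product J k bs) \<noteq> 0))"
    using assms
    by (intro ae_list_conj ae_list_all AE_nonzero_off_circle ae_list_ball ae_list_phase_product) auto
  then show "ae_list n (\<lambda>bs. AE c in lborel.
      \<not> ambiguous n k (\<lambda>i\<in>{..<Suc n}. c * coeff (reflected_prod {} bs) i))"
  proof (rule ae_list_mono)
    fix bs :: "complex list"
    assume "length bs = n" and bs: "(\<forall>b\<in>set bs. b \<noteq> 0 \<and> norm b \<noteq> 1) \<and>
      (\<forall>J\<in>Pow {..<n} - {{}}. Im (phase_product J k bs) \<noteq> 0)"
    show "AE c in lborel. \<not> ambiguous n k (\<lambda>i\<in>{..<Suc n}. c * coeff (reflected_prod {} bs) i)"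
      using AE_nonzero_off_circle
      by (rule eventually_mono)
        (use not_ambiguous_of_roots[OF \<open>length bs = n\<close>] assms bs in auto)
  qed
qed

section \<open>Real coordinates of signals\<close>

interpretation real_product: product_sigma_finite "\<lambda>_::nat. lborel :: real measure" ..

definition complex_of_coords :: "nat \<Rightarrow> (nat \<Rightarrow> real) \<Rightarrow> nat \<Rightarrow> complex" where
  "complex_of_coords N s = (\<lambda>i\<in>{..<N}. Complex (s (2 * i)) (s (2 * i + 1)))"

lemma measurable_complex_of_coords:
  "complex_of_coords N \<in> measurable (PiM {..<2 * N} (\<lambda>_. lborel)) (complex_coords N)"
  unfolding complex_of_coords_def[abs_def] Complex_eq
proof (rule measurable_restrict)
  fix i assume "i \<in> {..<N}"
  then have [measurable]: "(\<lambda>s. s (2 * i)) \<in> measurable (PiM {..<2 * N} (\<lambda>_. lborel)) (borel :: real measure)"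
     "(\<lambda>s. s (2 * i + 1)) \<in> measurable (PiM {..<2 * N} (\<lambda>_. lborel)) (borel :: real measure)"
    using measurable_component_singleton[of "2 * i" "{..<2 * N}" "\<lambda>_. lborel :: real measure"]
      measurable_component_singleton[of "2 * i + 1" "{..<2 * N}" "\<lambda>_. lborel :: real measure"]
    by simp_all
  show "(\<lambda>s. of_real (s (2 * i)) + \<i> * of_real (s (2 * i + 1)))
      \<in> measurable (PiM {..<2 * N} (\<lambda>_. lborel)) lborel"
    by measurable
qed

lemma AE_complex_of_coords:
  assumes "Measurable.pred (complex_coords N) R" and "AE a in complex_coords N. R a"
  shows "AE s in PiM {..<2 * N} (\<lambda>_. lborel). R (complex_of_coords N s)"
  using assms
proof (induction N arbitrary: R)
  case 0
  then show ?case
    unfolding mult_0_right lessThan_0 PiM_empty by (simp add: AE_count_space complex_of_coords_def)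
next
  case (Suc N)
  let ?M = "\<lambda>_::nat. lborel :: real measure"
  let ?P = "\<lambda>s. R (complex_of_coords (Suc N) s)"
  have idx: "{..<2 * Suc N} = insert (2 * N + 1) (insert (2 * N) {..<2 * N})" by auto
  have P: "Measurable.pred (PiM (insert (2 * N + 1) (insert (2 * N) {..<2 * N})) ?M) ?P"
    using measurable_compose[OF measurable_complex_of_coords[of "Suc N"] Suc.prems(1)] unfolding idx .
  have upd: "complex_of_coords (Suc N) (s(2 * N := u, 2 * N + 1 := v)) = (complex_of_coords N s)(N := Complex u v)"
    for s u v by (auto simp: complex_of_coords_def fun_eq_iff)
  have "AE a in complex_coords N. AE t in lborel. R (a(N := t))"
    using AE_complex_coords_Suc(1)[OF Suc.prems(1)] Suc.prems(2) by blast
  from Suc.IH[OF AE_complex_coords_Suc(2)[OF Suc.prems(1)] this]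
  have "AE s in PiM {..<2 * N} ?M. AE t in lborel. R ((complex_of_coords N s)(N := t))" .
  then have "AE s in PiM {..<2 * N} ?M. AE u in lborel. AE v in lborel.
      ?P (s(2 * N := u, 2 * N + 1 := v))"
    unfolding upd by (rule eventually_mono) (rule AE_lborel_Complex)
  moreover note ins = real_product.AE_PiM_insert[OF _ _ P]
  ultimately have "AE s in PiM (insert (2 * N) {..<2 * N}) ?M. AE v in lborel. ?P (s(2 * N + 1 := v))"
    by (subst real_product.AE_PiM_insert(1)[OF _ _ ins(2)]) simp_all
  then show ?case
    unfolding idx by (subst ins(1)) simp_all
qed

lemma same_phase_imp_nonneg:
  assumes "same_phase z w"
  shows "Im (z * cnj w) = 0 \<and> 0 \<le> Re (z * cnj w)"
proof (cases "z = 0 \<or> w = 0")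
  case False
  then have "Arg z = Arg w" using assms by (simp add: same_phase_def)
  then have "z = of_real (norm z) * cis (Arg w)" "w = of_real (norm w) * cis (Arg w)"
    by (metis rcis_cmod_Arg rcis_def)+
  then have "z * cnj w = of_real (norm z * norm w) * (cis (Arg w) * cnj (cis (Arg w)))"
    by (metis (no_types, lifting) complex_cnj_complex_of_real complex_cnj_mult mult.assoc mult.commute mult.left_commute of_real_mult)
  also have "cis (Arg w) * cnj (cis (Arg w)) = 1"
    by (simp add: complex_norm_square[symmetric])
  finally show ?thesis by simp
qed auto

lemma fourier_finite:
  assumes "has_support (Suc n) x"
  shows "fourier x \<omega> = (\<Sum>i\<le>n. x (int i) * cis (- \<omega>) ^ i)"
proof -
  have "fourier x \<omega> = (\<Sum>\<^sub>\<infinity>m\<in>int ` {..n}. x m * exp (- \<i> * of_real \<omega> * of_int m))"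
    unfolding fourier_def
  proof (rule infsum_cong_neutral)
    fix m :: int assume "m \<in> UNIV - int ` {..n}"
    then have "m \<notin> {0..int (Suc n) - 1}"
      by (auto simp: image_iff) (metis atMost_iff nat_le_iff nonneg_int_cases of_nat_le_iff)
    then show "x m * exp (- \<i> * of_real \<omega> * of_int m) = 0"
      using assms by (simp add: has_support_def)
  qed auto
  also have "\<dots> = (\<Sum>i\<le>n. x (int i) * exp (- \<i> * of_real \<omega> * of_int (int i)))"
    by (simp add: sum.reindex)
  also have "\<dots> = (\<Sum>i\<le>n. x (int i) * cis (- \<omega>) ^ i)"
    by (intro sum.cong refl arg_cong2[where f = "(*)"])
      (simp add: cis_conv_exp exp_of_nat_mult[symmetric] mult_ac)
  finally show ?thesis .
qed

lemma uniquely_recoverable_if_not_ambiguous: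
  assumes x: "has_support (Suc n) x" and "k \<le> n" and k: "int n - l = int k"
    and na: "\<not> ambiguous n k (\<lambda>i. x (int i))"
  shows "uniquely_recoverable (Suc n) l x"
  unfolding uniquely_recoverable_def
proof (intro allI impI)
  fix y
  assume "has_support (Suc n) y \<and> fourier_intensity y = fourier_intensity x \<and>
    same_phase (y (int (Suc n) - 1)) (x (int (Suc n) - 1)) \<and>
    same_phase (y (int (Suc n) - 1 - l)) (x (int (Suc n) - 1 - l))"
  then have y: "has_support (Suc n) y" and int_eq: "fourier_intensity y = fourier_intensity x"
    and ph: "same_phase (y (int n)) (x (int n))" "same_phase (y (int k)) (x (int k))"
    by (simp_all add: k)
  have "norm (\<Sum>i\<le>n. y (int i) * cis \<theta> ^ i) = norm (\<Sum>i\<le>n. x (int i) * cis \<theta> ^ i)" for \<theta>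
    using fun_cong[OF int_eq, of "- \<theta>"]
    by (simp add: fourier_intensity_def fourier_finite[OF x] fourier_finite[OF y])
  moreover have "\<forall>i\<in>{n, k}. Im (y (int i) * cnj (x (int i))) = 0 \<and> 0 \<le> Re (y (int i) * cnj (x (int i)))"
    using ph[THEN same_phase_imp_nonneg] by auto
  ultimately have "ambiguous n k (\<lambda>i. x (int i))" if "\<exists>i\<le>n. y (int i) \<noteq> x (int i)"
    unfolding ambiguous_def using that by (intro exI[of _ "\<lambda>i. y (int i)"]) blast
  with na have eq: "y (int i) = x (int i)" if "i \<le> n" for i
    using that by blast
  show "y = x"
  proof
    fix m
    show "y m = x m"
    proof (cases "m \<in> {0..int n}")
      case True
      then obtain i where "m = int i" "i \<le> n" by (metis atLeastAtMost_iff nonneg_int_cases of_nat_le_iff)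
      then show ?thesis using eq by simp
    next
      case False
      then have "x m = 0" "y m = 0" using x y unfolding has_support_def by auto
      then show ?thesis by simp
    qed
  qed
qed

theorem theorem4p3:
  fixes N :: nat and l :: int
  assumes "N \<ge> 3" and "1 \<le> l" and "l \<le> int N - 2"
  shows "almost_every_signal N (uniquely_recoverable N l)"
proof -
  obtain n where N: "N = Suc n" using assms(1) by (cases N) auto
  define k where "k = nat (int n - l)"
  have k: "int n - l = int k" using assms(3) N by (simp add: k_def)
  have kn: "1 \<le> k" "k < n" using assms(2,3) N k by auto
  let ?M = "PiM {..<2 * N} (\<lambda>_. lborel :: real measure)"
  let ?P = "\<lambda>s. \<not> ambiguous n k (complex_of_coords N s)"
  have amb: "Measurable.pred (complex_coords N) (ambiguous n k)"
    using measurable_ambiguous[of k n] kn N by simp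
  then have "Measurable.pred (complex_coords N) (\<lambda>a. \<not> ambiguous n k a)"
    by simp
  then have "AE s in ?M. ?P s"
    using AE_not_ambiguous[OF kn, folded N] by (rule AE_complex_of_coords)
  moreover have "Measurable.pred ?M (\<lambda>s. ambiguous n k (complex_of_coords N s))"
    by (rule measurable_compose[OF measurable_complex_of_coords amb])
  ultimately have "{s \<in> space ?M. \<not> ?P s} \<in> null_sets ?M"
    by (subst (asm) AE_iff_null) (simp_all add: pred_def)
  then have "{s \<in> space ?M. \<not> ?P s} \<in> null_sets (lebesgue_coords N)"
    unfolding lebesgue_coords_def by (rule null_sets_completionI)
  moreover have "uniquely_recoverable N l x"
    if x: "has_support N x" "signal_coords N x \<notin> {s \<in> space ?M. \<not> ?P s}" for x
  proof -
    have "signal_coords N x \<in> space ?M"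
      by (simp add: signal_coords_def space_PiM)
    then have "\<not> ambiguous n k (complex_of_coords N (signal_coords N x))" using x(2) by simp
    moreover have "complex_of_coords N (signal_coords N x) i = x (int i)" if "i \<le> n" for i
      using that N by (simp add: complex_of_coords_def signal_coords_def)
    ultimately have "\<not> ambiguous n k (\<lambda>i. x (int i))"
      using ambiguous_cong[of k n "complex_of_coords N (signal_coords N x)" "\<lambda>i. x (int i)"] kn by simp
    then show ?thesis
      using uniquely_recoverable_if_not_ambiguous[of n x k l] x(1) kn k N by simp
  qed
  ultimately show ?thesis
    unfolding almost_every_signal_def by blast
qed

end
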